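(* Let $\mathfrak V$ be a variety of algebras, let $\mathcal F\in\mathfrak V$ be a free $\mathfrak V$-algebra of infinite rank $\varkappa$, let $\mathcal B$ be a basis of $\mathcal F$, and let $\lambda<\varkappa$ be an infinite cardinal. Then the group $$G=\mathrm{Aut}_{\lambda,\mathcal B}(\mathcal F)=\{\varphi\in\mathrm{Aut}(\mathcal F): |\mathrm{supp}(\varphi)|\leq\lambda\}$$ is a group of finite $C$-width.
   Context: A variety of algebras is taken in the sense of universal algebra. A basis of a free $\mathfrak V$-algebra $\mathcal F$ is a free generating set of $\mathcal F$, and the rank is the cardinality of a basis. For $\varphi\in\mathrm{Aut}(\mathcal F)$, the support of $\varphi$ (with respect to the fixed basis $\mathcal B$) is $\mathrm{supp}(\varphi)=\{b\in\mathcal B: \varphi b\neq b\}$. The set $\mathrm{Aut}_{\lambda,\mathcal B}(\mathcal F)$ is a subgroup of the automorphism group $\mathrm{Aut}(\mathcal F)$. For a group $G$ and a generating set $S$ of $G$, the length $|g|_S$ of $g\in G$ is the least number of elements of $S\cup S^{-1}$ whose product is $g$; the width of $G$ relative to $S$ is $\mathrm{wid}(G,S)=\sup\{|g|_S: g\in G\}$. A generating set $S$ of $G$ is conjugation-invariant if $gSg^{-1}=S$ for all $g\in G$. The group $G$ is a group of finite $C$-width if $\mathrm{wid}(G,S)<\infty$ for every conjugation-invariant generating set $S$ of $G$. *)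

theory Defs
  imports
    "HOL-Algebra.Bij"
    "HOL-Algebra.Generated_Groups"
    "HOL-Library.Extended_Nat"
begin

unbundle cardinal_syntax

section \<open>Algebras, terms and varieties\<close>

record 'f signature =
  symbols :: "'f set"
  arity :: "'f \<Rightarrow> nat"

text \<open>
  The value of \<open>interp A f xs\<close> is meaningful only for a symbol \<open>f\<close> of the signature and a list
  \<open>xs\<close> over the universe whose length is the arity of \<open>f\<close>; see \<open>arguments\<close>.
\<close>

record ('f, 'a) universal_algebra =
  universe :: "'a set"
  interp :: "'f \<Rightarrow> 'a list \<Rightarrow> 'a"

definition arguments :: "'f signature \<Rightarrow> 'f \<Rightarrow> 'a set \<Rightarrow> 'a list set" where
  "arguments Sig f X = {xs \<in> lists X. length xs = arity Sig f}"

definition is_algebra :: "'f signature \<Rightarrow> ('f, 'a) universal_algebra \<Rightarrow> bool" where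
  "is_algebra Sig A \<longleftrightarrow>
     (\<forall>f\<in>symbols Sig. \<forall>xs\<in>arguments Sig f (universe A). interp A f xs \<in> universe A)"

definition alg_hom ::
  "'f signature \<Rightarrow> ('f, 'a) universal_algebra \<Rightarrow> ('f, 'b) universal_algebra \<Rightarrow> ('a \<Rightarrow> 'b) set" where
  "alg_hom Sig A B = {h. h ` universe A \<subseteq> universe B \<and>
     (\<forall>f\<in>symbols Sig. \<forall>xs\<in>arguments Sig f (universe A).
        h (interp A f xs) = interp B f (map h xs))}"

datatype ('f, 'v) trm = Var 'v | App 'f "('f, 'v) trm list"

inductive_set sig_terms :: "'f signature \<Rightarrow> 'v set \<Rightarrow> ('f, 'v) trm set"
  for Sig :: "'f signature" and V :: "'v set" where
  Var: "x \<in> V \<Longrightarrow> Var x \<in> sig_terms Sig V"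
| App: "f \<in> symbols Sig \<Longrightarrow> length ts = arity Sig f \<Longrightarrow> \<forall>t\<in>set ts. t \<in> sig_terms Sig V
    \<Longrightarrow> App f ts \<in> sig_terms Sig V"

primrec eval_trm :: "('f, 'a) universal_algebra \<Rightarrow> ('v \<Rightarrow> 'a) \<Rightarrow> ('f, 'v) trm \<Rightarrow> 'a" where
  "eval_trm A v (Var x) = v x"
| "eval_trm A v (App f ts) = interp A f (map (eval_trm A v) ts)"

text \<open>
  A variety is given by a signature and a set of identities, that is, pairs of terms in countably
  many variables; its members, over every carrier type, are the algebras of the signature that
  satisfy all the identities.
\<close>

type_synonym 'f identities = "(('f, nat) trm \<times> ('f, nat) trm) set"

definition is_identities :: "'f signature \<Rightarrow> 'f identities \<Rightarrow> bool" where
  "is_identities Sig E \<longleftrightarrow> E \<subseteq> sig_terms Sig UNIV \<times> sig_terms Sig UNIV"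

definition in_variety ::
  "'f signature \<Rightarrow> 'f identities \<Rightarrow> ('f, 'a) universal_algebra \<Rightarrow> bool" where
  "in_variety Sig E A \<longleftrightarrow> is_algebra Sig A \<and>
     (\<forall>(s, t)\<in>E. \<forall>v. range v \<subseteq> universe A \<longrightarrow> eval_trm A v s = eval_trm A v t)"


section \<open>Free algebras\<close>

inductive_set subalgebra_generated ::
  "'f signature \<Rightarrow> ('f, 'a) universal_algebra \<Rightarrow> 'a set \<Rightarrow> 'a set"
  for Sig :: "'f signature" and A :: "('f, 'a) universal_algebra" and X :: "'a set" where
  incl: "x \<in> X \<Longrightarrow> x \<in> subalgebra_generated Sig A X"
| app: "f \<in> symbols Sig \<Longrightarrow> length xs = arity Sig f
    \<Longrightarrow> \<forall>x\<in>set xs. x \<in> subalgebra_generated Sig A X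
    \<Longrightarrow> interp A f xs \<in> subalgebra_generated Sig A X"

text \<open>
  A definition cannot quantify over the carrier types of the algebras of the variety. The test
  algebras below are carried by sets of terms over the carrier type of \<open>F\<close>; this is enough, since
  \<open>free_basis_extends\<close> below yields the mapping property for algebras over an arbitrary type.
\<close>

definition free_basis ::
  "'f signature \<Rightarrow> 'f identities \<Rightarrow> ('f, 'a) universal_algebra \<Rightarrow> 'a set \<Rightarrow> bool" where
  "free_basis Sig E F B \<longleftrightarrow>
     in_variety Sig E F \<and> B \<subseteq> universe F \<and> subalgebra_generated Sig F B = universe F \<and>
     (\<forall>(A :: ('f, ('f, 'a) trm) universal_algebra) g.
        in_variety Sig E A \<and> g ` B \<subseteq> universe A \<longrightarrow>
        (\<exists>h\<in>alg_hom Sig F A. \<forall>b\<in>B. h b = g b))"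

lemma eval_trm_sig_terms:
  assumes "is_algebra Sig A" "v ` V \<subseteq> universe A" "t \<in> sig_terms Sig V"
  shows "eval_trm A v t \<in> universe A"
  using assms(3)
proof induction
  case (App f ts)
  then have "map (eval_trm A v) ts \<in> arguments Sig f (universe A)"
    by (auto simp: arguments_def in_lists_conv_set)
  with App assms(1) show ?case by (auto simp: is_algebra_def)
qed (use assms in auto)

theorem free_basis_extends:
  fixes A :: "('f, 'b) universal_algebra" and F :: "('f, 'a) universal_algebra"
  assumes F: "free_basis Sig E F B" and E: "is_identities Sig E"
    and A: "in_variety Sig E A" and g: "g ` B \<subseteq> universe A"
  shows "\<exists>h\<in>alg_hom Sig F A. \<forall>b\<in>B. h b = g b"
proof -
  define ev :: "('f, 'a) trm \<Rightarrow> 'b" where "ev = eval_trm A g"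
  define r where "r x = (SOME t. t \<in> sig_terms Sig B \<and> ev t = x)" for x
  define X where "X = ev ` sig_terms Sig B"
  have r: "r x \<in> sig_terms Sig B" "ev (r x) = x" if "x \<in> X" for x
  proof -
    from that have "\<exists>t. t \<in> sig_terms Sig B \<and> ev t = x" by (auto simp: X_def)
    from someI_ex[OF this] show "r x \<in> sig_terms Sig B" "ev (r x) = x" by (auto simp: r_def)
  qed
  have evr: "ev t \<in> X" "r (ev t) = t" if "t \<in> r ` X" for t
    using that r(2) by auto
  have alg: "is_algebra Sig A" using A by (simp add: in_variety_def)
  have XA: "X \<subseteq> universe A"
    using eval_trm_sig_terms[OF alg g] by (auto simp: X_def ev_def)
  have closed: "interp A f xs \<in> X" if f: "f \<in> symbols Sig" and xs: "xs \<in> arguments Sig f X" for f xs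
  proof -
    have "App f (map r xs) \<in> sig_terms Sig B"
      using f xs r by (intro sig_terms.App) (auto simp: arguments_def in_lists_conv_set)
    moreover have "ev (App f (map r xs)) = interp A f xs"
    proof -
      have "map ev (map r xs) = xs"
        using xs r by (auto simp: arguments_def in_lists_conv_set intro!: map_idI)
      then show ?thesis by (simp add: ev_def)
    qed
    ultimately show ?thesis unfolding X_def by (metis imageI)
  qed
  define T :: "('f, ('f, 'a) trm) universal_algebra" where
    "T = \<lparr>universe = r ` X, interp = (\<lambda>f ts. r (interp A f (map ev ts)))\<rparr>"
  have argsT: "map ev ts \<in> arguments Sig f X" if "ts \<in> arguments Sig f (universe T)" for f ts
    using that evr(1) by (auto simp: arguments_def in_lists_conv_set T_def)
  have algT: "is_algebra Sig T"
    unfolding is_algebra_def using closed argsT by (auto simp: T_def)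
  have evT: "ev (eval_trm T v t) = eval_trm A (\<lambda>x. ev (v x)) t \<and> eval_trm A (\<lambda>x. ev (v x)) t \<in> X"
    if v: "range v \<subseteq> universe T" and t: "t \<in> sig_terms Sig UNIV" for v :: "nat \<Rightarrow> _" and t
    using t
  proof induction
    case (Var x)
    have "v x \<in> r ` X" using v by (auto simp: T_def)
    then show ?case using evr(1) by simp
  next
    case (App f ts)
    have eq: "map (ev \<circ> eval_trm T v) ts = map (eval_trm A (\<lambda>x. ev (v x))) ts"
      using App by auto
    have "map (eval_trm A (\<lambda>x. ev (v x))) ts \<in> arguments Sig f X"
      using App by (auto simp: arguments_def in_lists_conv_set)
    from closed[OF App(1) this] have X: "interp A f (map (eval_trm A (\<lambda>x. ev (v x))) ts) \<in> X" .
    have "eval_trm T v (App f ts) = r (interp A f (map (ev \<circ> eval_trm T v) ts))"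
      by (simp add: T_def)
    then have "eval_trm T v (App f ts) = r (interp A f (map (eval_trm A (\<lambda>x. ev (v x))) ts))"
      by (simp only: eq)
    then show ?case using r(2)[OF X] X by (simp only: eval_trm.simps simp_thms)
  qed
  have "in_variety Sig E T"
    unfolding in_variety_def
  proof (intro conjI algT ballI, clarify)
    fix s t and v :: "nat \<Rightarrow> ('f, 'a) trm"
    assume st: "(s, t) \<in> E" and v: "range v \<subseteq> universe T"
    have s: "s \<in> sig_terms Sig UNIV" and t: "t \<in> sig_terms Sig UNIV"
      using E st by (auto simp: is_identities_def)
    have "range (\<lambda>x. ev (v x)) \<subseteq> universe A"
      using v evr(1) XA by (auto simp: T_def image_subset_iff)
    then have "eval_trm A (\<lambda>x. ev (v x)) s = eval_trm A (\<lambda>x. ev (v x)) t"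
      using A st unfolding in_variety_def by blast
    then have "ev (eval_trm T v s) = ev (eval_trm T v t)"
      using evT[OF v s] evT[OF v t] by simp
    moreover have "eval_trm T v s \<in> r ` X" "eval_trm T v t \<in> r ` X"
      using eval_trm_sig_terms[OF algT v s] eval_trm_sig_terms[OF algT v t] by (auto simp: T_def)
    ultimately show "eval_trm T v s = eval_trm T v t"
      using evr(2) by metis
  qed
  moreover have gX: "g b \<in> X" if "b \<in> B" for b
    using sig_terms.Var[OF that, of Sig] by (force simp: X_def ev_def)
  then have "(r \<circ> g) ` B \<subseteq> universe T" by (auto simp: T_def)
  ultimately obtain h where h: "h \<in> alg_hom Sig F T" "\<forall>b\<in>B. h b = (r \<circ> g) b"
    using F unfolding free_basis_def by meson
  have hX: "h x \<in> r ` X" if "x \<in> universe F" for x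
    using h that by (auto simp: alg_hom_def T_def)
  have "ev \<circ> h \<in> alg_hom Sig F A"
    unfolding alg_hom_def
  proof (intro CollectI conjI ballI)
    show "(ev \<circ> h) ` universe F \<subseteq> universe A"
      using hX evr(1) XA by auto
    fix f xs assume f: "f \<in> symbols Sig" and xs: "xs \<in> arguments Sig f (universe F)"
    have "h (interp F f xs) = r (interp A f (map ev (map h xs)))"
      using h f xs by (auto simp: alg_hom_def T_def)
    moreover have "map h xs \<in> arguments Sig f (universe T)"
      using xs hX by (auto simp: arguments_def in_lists_conv_set T_def)
    then have "interp A f (map ev (map h xs)) \<in> X"
      using closed[OF f] argsT by blast
    ultimately show "(ev \<circ> h) (interp F f xs) = interp A f (map (ev \<circ> h) xs)"
      using r(2) by simp
  qed
  moreover have "\<forall>b\<in>B. (ev \<circ> h) b = g b" using h gX r(2) by simp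
  ultimately show ?thesis by blast
qed


section \<open>Automorphisms of bounded support\<close>

text \<open>
  As in \<open>BijGroup\<close>, automorphisms are extensional functions, so that equality of automorphisms
  is equality on the universe.
\<close>

definition alg_auto :: "'f signature \<Rightarrow> ('f, 'a) universal_algebra \<Rightarrow> ('a \<Rightarrow> 'a) set" where
  "alg_auto Sig F = alg_hom Sig F F \<inter> Bij (universe F)"

definition Aut :: "'f signature \<Rightarrow> ('f, 'a) universal_algebra \<Rightarrow> ('a \<Rightarrow> 'a) monoid" where
  "Aut Sig F = BijGroup (universe F) \<lparr>carrier := alg_auto Sig F\<rparr>"

definition supp :: "'a set \<Rightarrow> ('a \<Rightarrow> 'a) \<Rightarrow> 'a set" where
  "supp B \<phi> = {b \<in> B. \<phi> b \<noteq> b}"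

definition Aut_le ::
  "'c rel \<Rightarrow> 'a set \<Rightarrow> 'f signature \<Rightarrow> ('f, 'a) universal_algebra \<Rightarrow> ('a \<Rightarrow> 'a) monoid" where
  "Aut_le lam B Sig F = (Aut Sig F) \<lparr>carrier := {\<phi> \<in> carrier (Aut Sig F). |supp B \<phi>| \<le>o lam}\<rparr>"

lemma subgroup_alg_auto:
  assumes alg: "is_algebra Sig F"
  shows "subgroup (alg_auto Sig F) (BijGroup (universe F))"
proof (rule group.subgroupI[OF group_BijGroup])
  let ?U = "universe F"
  show "alg_auto Sig F \<subseteq> carrier (BijGroup ?U)"
    by (auto simp: alg_auto_def BijGroup_def)
  have cl: "interp F f xs \<in> ?U" if "f \<in> symbols Sig" "xs \<in> arguments Sig f ?U" for f xs
    using alg that by (auto simp: is_algebra_def)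
  have sub: "set xs \<subseteq> ?U" if "xs \<in> arguments Sig f ?U" for f xs
    using that by (auto simp: arguments_def in_lists_conv_set)
  have "(\<lambda>x\<in>?U. x) \<in> alg_hom Sig F F"
  proof -
    have "map (\<lambda>x\<in>?U. x) xs = xs" if "xs \<in> arguments Sig f ?U" for f xs
      using sub[OF that] by (intro map_idI) auto
    then show ?thesis using cl by (auto simp: alg_hom_def)
  qed
  then show "alg_auto Sig F \<noteq> {}"
    using id_Bij by (auto simp: alg_auto_def)
  fix a assume a: "a \<in> alg_auto Sig F"
  then have bij: "bij_betw a ?U ?U" and aB: "a \<in> Bij ?U" by (auto simp: alg_auto_def Bij_def)
  have aU: "a ` ?U = ?U" using bij by (simp add: bij_betw_def)
  have inv: "inv\<^bsub>BijGroup ?U\<^esub> a = (\<lambda>x\<in>?U. inv_into ?U a x)"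
    using inv_BijGroup[OF aB] .
  let ?i = "\<lambda>x\<in>?U. inv_into ?U a x"
  have "?i (interp F f xs) = interp F f (map ?i xs)"
    if f: "f \<in> symbols Sig" and xs: "xs \<in> arguments Sig f ?U" for f xs
  proof -
    have ixs: "map ?i xs \<in> arguments Sig f ?U"
      using sub[OF xs] xs aU by (auto simp: arguments_def in_lists_conv_set inv_into_into)
    have "map a (map ?i xs) = xs"
      unfolding map_map using sub[OF xs] aU by (intro map_idI) (auto simp: f_inv_into_f)
    then have "a (interp F f (map ?i xs)) = interp F f xs"
      using a f ixs by (auto simp: alg_auto_def alg_hom_def)
    then have "?i (interp F f xs) = inv_into ?U a (a (interp F f (map ?i xs)))"
      using cl[OF f xs] by simp
    also have "\<dots> = interp F f (map ?i xs)"
      using bij_betw_inv_into_left[OF bij cl[OF f ixs]] .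
    finally show ?thesis .
  qed
  moreover have "?i ` ?U \<subseteq> ?U"
    using aU by (auto simp: inv_into_into)
  ultimately have "?i \<in> alg_hom Sig F F"
    unfolding alg_hom_def by blast
  then show "inv\<^bsub>BijGroup ?U\<^esub> a \<in> alg_auto Sig F"
    using restrict_inv_into_Bij[OF aB] by (simp add: inv alg_auto_def)
  fix b assume b: "b \<in> alg_auto Sig F"
  then have bB: "b \<in> Bij ?U" by (auto simp: alg_auto_def)
  have bU: "b ` ?U = ?U" using bB by (simp add: Bij_def bij_betw_def)
  have "compose ?U a b (interp F f xs) = interp F f (map (compose ?U a b) xs)"
    if f: "f \<in> symbols Sig" and xs: "xs \<in> arguments Sig f ?U" for f xs
  proof -
    have "map (compose ?U a b) xs = map a (map b xs)"
      using sub[OF xs] by (auto simp: compose_def)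
    moreover have "map b xs \<in> arguments Sig f ?U"
      using sub[OF xs] xs bU by (auto simp: arguments_def in_lists_conv_set)
    moreover have "compose ?U a b (interp F f xs) = a (b (interp F f xs))"
      using cl[OF f xs] by (simp add: compose_def)
    ultimately show ?thesis
      using a b f xs by (simp add: alg_auto_def alg_hom_def del: map_map)
  qed
  moreover have "compose ?U a b ` ?U \<subseteq> ?U"
    using aU bU by (auto simp: compose_def)
  ultimately have "compose ?U a b \<in> alg_hom Sig F F"
    unfolding alg_hom_def by blast
  then show "a \<otimes>\<^bsub>BijGroup ?U\<^esub> b \<in> alg_auto Sig F"
    using aB bB compose_Bij[OF aB bB] by (simp add: BijGroup_def alg_auto_def)
qed

lemma group_Aut:
  assumes "is_algebra Sig F"
  shows "group (Aut Sig F)"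
  unfolding Aut_def
  by (rule subgroup.subgroup_is_group[OF subgroup_alg_auto[OF assms] group_BijGroup])

lemma subgroup_Aut_le:
  assumes alg: "is_algebra Sig F" and B: "B \<subseteq> universe F" and lam: "Cinfinite lam"
  shows "subgroup (carrier (Aut_le lam B Sig F)) (Aut Sig F)"
proof (rule group.subgroupI[OF group_Aut[OF alg]])
  let ?U = "universe F"
  have car: "carrier (Aut_le lam B Sig F) = {\<phi> \<in> alg_auto Sig F. |supp B \<phi>| \<le>o lam}"
    by (simp add: Aut_le_def Aut_def)
  show "carrier (Aut_le lam B Sig F) \<subseteq> carrier (Aut Sig F)"
    by (auto simp: Aut_le_def)
  have one: "\<one>\<^bsub>Aut Sig F\<^esub> = (\<lambda>x\<in>?U. x)" by (simp add: Aut_def BijGroup_def)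
  have "supp B (\<lambda>x\<in>?U. x) = {}" using B by (auto simp: supp_def)
  then have "|supp B (\<lambda>x\<in>?U. x)| \<le>o lam" using lam by (simp add: card_of_empty1)
  moreover have "(\<lambda>x\<in>?U. x) \<in> alg_auto Sig F"
    using group.is_monoid[OF group_Aut[OF alg], THEN monoid.one_closed] one
    by (simp add: Aut_def)
  ultimately show "carrier (Aut_le lam B Sig F) \<noteq> {}" unfolding car by blast
  fix a assume a: "a \<in> carrier (Aut_le lam B Sig F)"
  then have aA: "a \<in> alg_auto Sig F" and aS: "|supp B a| \<le>o lam" by (auto simp: car)
  then have aB: "a \<in> Bij ?U" by (auto simp: alg_auto_def)
  then have bij: "bij_betw a ?U ?U" by (simp add: Bij_def)
  have inv: "inv\<^bsub>Aut Sig F\<^esub> a = (\<lambda>x\<in>?U. inv_into ?U a x)"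
    using group.m_inv_consistent[OF group_BijGroup subgroup_alg_auto[OF alg] aA] inv_BijGroup[OF aB]
    by (simp add: Aut_def)
  have "supp B (\<lambda>x\<in>?U. inv_into ?U a x) \<subseteq> supp B a"
    using B bij_betw_inv_into_left[OF bij] by (fastforce simp: supp_def)
  then have "|supp B (inv\<^bsub>Aut Sig F\<^esub> a)| \<le>o lam"
    using ordLeq_transitive[OF card_of_mono1 aS] by (simp add: inv)
  moreover have "inv\<^bsub>Aut Sig F\<^esub> a \<in> alg_auto Sig F"
    using group.inv_closed[OF group_Aut[OF alg], of a] aA by (simp add: Aut_def)
  ultimately show "inv\<^bsub>Aut Sig F\<^esub> a \<in> carrier (Aut_le lam B Sig F)" by (simp add: car)
  fix b assume b: "b \<in> carrier (Aut_le lam B Sig F)"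
  then have bA: "b \<in> alg_auto Sig F" and bS: "|supp B b| \<le>o lam" by (auto simp: car)
  then have bB: "b \<in> Bij ?U" by (auto simp: alg_auto_def)
  have m: "a \<otimes>\<^bsub>Aut Sig F\<^esub> b = compose ?U a b"
    using aB bB by (simp add: Aut_def BijGroup_def)
  have "supp B (compose ?U a b) \<subseteq> supp B a \<union> supp B b"
    using B by (auto simp: supp_def compose_def)
  then have "|supp B (a \<otimes>\<^bsub>Aut Sig F\<^esub> b)| \<le>o lam"
    using ordLeq_transitive[OF card_of_mono1 Un_Cinfinite_bound[OF aS bS lam]] by (simp add: m)
  moreover have "a \<otimes>\<^bsub>Aut Sig F\<^esub> b \<in> alg_auto Sig F"
    using monoid.m_closed[OF group.is_monoid[OF group_Aut[OF alg]], of a b] aA bA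
    by (simp add: Aut_def)
  ultimately show "a \<otimes>\<^bsub>Aut Sig F\<^esub> b \<in> carrier (Aut_le lam B Sig F)" by (simp add: car)
qed


section \<open>Width of groups\<close>

definition word_value :: "('g, 'm) monoid_scheme \<Rightarrow> 'g list \<Rightarrow> 'g" where
  "word_value G ws = foldr (\<lambda>x y. x \<otimes>\<^bsub>G\<^esub> y) ws \<one>\<^bsub>G\<^esub>"

definition word_length :: "('g, 'm) monoid_scheme \<Rightarrow> 'g set \<Rightarrow> 'g \<Rightarrow> enat" where
  "word_length G S g =
     (INF ws \<in> {ws \<in> lists (S \<union> m_inv G ` S). word_value G ws = g}. enat (length ws))"

definition width :: "('g, 'm) monoid_scheme \<Rightarrow> 'g set \<Rightarrow> enat" where
  "width G S = (SUP g \<in> carrier G. word_length G S g)"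

definition generating_set :: "('g, 'm) monoid_scheme \<Rightarrow> 'g set \<Rightarrow> bool" where
  "generating_set G S \<longleftrightarrow> S \<subseteq> carrier G \<and> generate G S = carrier G"

definition conjugation_invariant :: "('g, 'm) monoid_scheme \<Rightarrow> 'g set \<Rightarrow> bool" where
  "conjugation_invariant G S \<longleftrightarrow>
     (\<forall>g\<in>carrier G. (\<lambda>s. g \<otimes>\<^bsub>G\<^esub> s \<otimes>\<^bsub>G\<^esub> inv\<^bsub>G\<^esub> g) ` S = S)"

definition finite_C_width :: "('g, 'm) monoid_scheme \<Rightarrow> bool" where
  "finite_C_width G \<longleftrightarrow> group G \<and>
     (\<forall>S. generating_set G S \<and> conjugation_invariant G S \<longrightarrow> width G S < \<infinity>)"

end

theory Submission
  imports Defs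
begin

text \<open>
  Write \<open>G\<close> for the group of automorphisms with support of size at most \<open>\<lambda>\<close>, and fix a
  conjugation-invariant generating set. If the lengths were unbounded, there would be \<open>\<phi> n \<in> G\<close>
  of length greater than \<open>n\<close> for every \<open>n\<close>. The proof packs the whole sequence into a single
  \<open>\<psi> \<in> G\<close> such that every \<open>\<phi> n\<close> is a conjugate of \<open>\<psi>\<close> times a conjugate of \<open>\<psi>\<inverse>\<close>. Since
  length is invariant under conjugation and inversion, all the \<open>\<phi> n\<close> then have length at most
  twice the length of \<open>\<psi>\<close>, a contradiction (\<open>finite_C_widthI\<close>).

  The element \<open>\<psi>\<close> is built by an infinite swindle. Each basis element is moved by \<open>\<phi> n\<close> or its
  inverse to a value of a term in finitely many basis elements, so one set \<open>C \<subseteq> B\<close> with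
  \<open>|C| \<le> \<lambda>\<close> carries all the \<open>\<phi> n\<close>: they preserve the subalgebra generated by \<open>C\<close> and fix
  \<open>B - C\<close> pointwise (\<open>common_domain\<close>). As \<open>\<lambda> < |B|\<close>, there is room outside \<open>C\<close> for disjoint
  copies \<open>D (n, k)\<close> of \<open>C\<close>, with \<open>n\<close> a natural number and \<open>k\<close> an integer
  (\<open>disjoint_copies\<close>). Conjugation by the permutation of \<open>B\<close> that exchanges \<open>C\<close> and \<open>D (n, k)\<close>
  turns \<open>\<phi> n\<close> into a copy \<open>\<theta> (n, k)\<close> that acts on \<open>D (n, k)\<close>. Freeness allows the copies with
  \<open>k \<ge> 0\<close> to be glued to one automorphism \<open>\<psi>\<close> (\<open>glue\<close>). Its support is still of size at most
  \<open>\<lambda>\<close>. If \<open>g\<close> shifts row \<open>n\<close> by one, \<open>D (n, k)\<close> to \<open>D (n, k + 1)\<close>, then \<open>g \<psi> g\<inverse>\<close> differs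
  from \<open>\<psi>\<close> only in lacking the copy at \<open>(n, 0)\<close>. Hence \<open>\<theta> (n, 0) = \<psi> g \<psi>\<inverse> g\<inverse>\<close>, and \<open>\<phi> n\<close> is
  conjugate to that (\<open>absorbing_automorphism\<close>, \<open>conjugated_commutator\<close>).
\<close>


section \<open>A criterion for finite C-width\<close>

lemma (in group) word_value_closed:
  "set ws \<subseteq> carrier G \<Longrightarrow> word_value G ws \<in> carrier G"
  by (induction ws) (auto simp: word_value_def)

lemma (in group) word_value_append:
  assumes "set us \<subseteq> carrier G" "set vs \<subseteq> carrier G"
  shows "word_value G (us @ vs) = word_value G us \<otimes> word_value G vs"
  using assms
proof (induction us)
  case (Cons u us)
  then have "word_value G us \<in> carrier G" "word_value G vs \<in> carrier G"
    by (auto intro: word_value_closed)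
  then show ?case using Cons by (auto simp: word_value_def m_assoc)
qed (use word_value_closed in \<open>auto simp: word_value_def\<close>)

lemma (in group) word_value_conj:
  assumes "set ws \<subseteq> carrier G" "x \<in> carrier G"
  shows "word_value G (map (\<lambda>s. x \<otimes> s \<otimes> inv x) ws) = x \<otimes> word_value G ws \<otimes> inv x"
  using assms
proof (induction ws)
  case (Cons w ws)
  then have w: "w \<in> carrier G" "word_value G ws \<in> carrier G" "x \<in> carrier G"
    by (auto intro: word_value_closed)
  then have "x \<otimes> w \<otimes> inv x \<otimes> (x \<otimes> word_value G ws \<otimes> inv x) = x \<otimes> (w \<otimes> word_value G ws) \<otimes> inv x"
    by (simp add: m_assoc) (simp flip: m_assoc)
  then show ?case using Cons by (auto simp: word_value_def)
qed (auto simp: word_value_def)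

lemma (in group) word_value_inv:
  assumes "set ws \<subseteq> carrier G"
  shows "word_value G (map (m_inv G) (rev ws)) = inv (word_value G ws)"
  using assms
proof (induction ws)
  case (Cons w ws)
  then have w: "w \<in> carrier G" "word_value G ws \<in> carrier G"
    by (auto intro: word_value_closed)
  have "word_value G (map (m_inv G) (rev ws) @ [inv w]) = inv (word_value G ws) \<otimes> inv w"
    using Cons by (subst word_value_append) (auto simp: word_value_def)
  moreover have "word_value G (w # ws) = w \<otimes> word_value G ws" by (simp add: word_value_def)
  ultimately show ?case using w by (simp add: inv_mult_group)
qed (auto simp: word_value_def)

lemma (in group) generate_word:
  assumes "S \<subseteq> carrier G" "g \<in> generate G S"
  shows "\<exists>ws\<in>lists (S \<union> m_inv G ` S). word_value G ws = g"
  using assms(2)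
proof induction
  case one
  show ?case by (rule bexI[of _ "[]"]) (auto simp: word_value_def)
next
  case (incl h)
  then show ?case using assms(1) by (intro bexI[of _ "[h]"]) (auto simp: word_value_def)
next
  case (inv h)
  then show ?case using assms(1) by (intro bexI[of _ "[inv h]"]) (auto simp: word_value_def)
next
  case (eng h1 h2)
  then obtain us vs where "us \<in> lists (S \<union> m_inv G ` S)" "word_value G us = h1"
    "vs \<in> lists (S \<union> m_inv G ` S)" "word_value G vs = h2" by blast
  moreover have "S \<union> m_inv G ` S \<subseteq> carrier G" using assms(1) by auto
  ultimately show ?case
    by (intro bexI[of _ "us @ vs"] word_value_append[THEN trans]) (auto simp: in_lists_conv_set)
qed

text \<open>
  A word for \<open>\<psi>\<close> over a conjugation-invariant set yields, letter by letter, words of the same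
  length for all conjugates of \<open>\<psi>\<close> and of its inverse. So one element \<open>\<psi>\<close> bounds the lengths of
  all the \<open>\<phi> n\<close> at once, which is impossible if \<open>\<phi> n\<close> was chosen of length more than \<open>n\<close>.
\<close>

lemma (in group) finite_C_widthI:
  assumes absorb: "\<And>\<phi> :: nat \<Rightarrow> 'a. range \<phi> \<subseteq> carrier G \<Longrightarrow>
    \<exists>\<psi>\<in>carrier G. \<forall>n. \<exists>x\<in>carrier G. \<exists>y\<in>carrier G.
      \<phi> n = (x \<otimes> \<psi> \<otimes> inv x) \<otimes> (y \<otimes> inv \<psi> \<otimes> inv y)"
  shows "finite_C_width G"
  unfolding finite_C_width_def
proof (intro conjI allI impI, rule is_group, elim conjE)
  fix S assume gen: "generating_set G S" and conj: "conjugation_invariant G S"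
  let ?S = "S \<union> m_inv G ` S"
  have S: "S \<subseteq> carrier G" using gen by (simp add: generating_set_def)
  then have SG: "?S \<subseteq> carrier G" by auto
  have S_inv: "inv s \<in> ?S" if "s \<in> ?S" for s using that S by auto
  have S_conj: "x \<otimes> s \<otimes> inv x \<in> ?S" if x: "x \<in> carrier G" and s: "s \<in> ?S" for x s
  proof -
    have cS: "x \<otimes> t \<otimes> inv x \<in> S" if "t \<in> S" for t
      using conj x that unfolding conjugation_invariant_def by blast
    show ?thesis
    proof (cases "s \<in> S")
      case False
      then obtain t where t: "t \<in> S" "s = inv t" using s by blast
      then have "x \<otimes> s \<otimes> inv x = inv (x \<otimes> t \<otimes> inv x)"
        using x S by (auto simp: inv_mult_group m_assoc subset_iff)
      then show ?thesis using cS[OF t(1)] by auto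
    qed (use cS in auto)
  qed
  show "width G S < \<infinity>"
  proof (rule ccontr)
    assume "\<not> width G S < \<infinity>"
    then have "\<not> width G S \<le> enat n" for n by auto
    then have "\<exists>g\<in>carrier G. \<not> word_length G S g \<le> enat n" for n
      unfolding width_def by (meson SUP_least)
    then obtain \<phi> where \<phi>: "\<And>n. \<phi> n \<in> carrier G" "\<And>n. \<not> word_length G S (\<phi> n) \<le> enat n"
      by metis
    then have "range \<phi> \<subseteq> carrier G" by blast
    from absorb[OF this] obtain \<psi> where \<psi>: "\<psi> \<in> carrier G"
      and prod: "\<And>n. \<exists>x\<in>carrier G. \<exists>y\<in>carrier G.
        \<phi> n = (x \<otimes> \<psi> \<otimes> inv x) \<otimes> (y \<otimes> inv \<psi> \<otimes> inv y)" by blast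
    obtain ws where ws: "ws \<in> lists ?S" "word_value G ws = \<psi>"
      using generate_word[OF S, of \<psi>] \<psi> gen by (auto simp: generating_set_def)
    have wsG: "set ws \<subseteq> carrier G" using ws SG by (auto simp: in_lists_conv_set)
    let ?n = "length ws + length ws"
    obtain x y where x: "x \<in> carrier G" and y: "y \<in> carrier G"
      and eq: "\<phi> ?n = (x \<otimes> \<psi> \<otimes> inv x) \<otimes> (y \<otimes> inv \<psi> \<otimes> inv y)" using prod by blast
    let ?us = "map (\<lambda>s. x \<otimes> s \<otimes> inv x) ws"
    let ?vs = "map (\<lambda>s. y \<otimes> s \<otimes> inv y) (map (m_inv G) (rev ws))"
    have letters: "s \<in> ?S" if "s \<in> set ws" for s using ws that by (simp add: in_lists_conv_set)
    have us: "set ?us \<subseteq> ?S"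
      unfolding set_map by (intro image_subsetI S_conj[OF x letters])
    have vs: "set ?vs \<subseteq> ?S"
      unfolding set_map set_rev image_image by (intro image_subsetI S_conj[OF y S_inv[OF letters]])
    have "word_value G (?us @ ?vs) = word_value G ?us \<otimes> word_value G ?vs"
      by (intro word_value_append subset_trans[OF us SG] subset_trans[OF vs SG])
    also have "word_value G ?us = x \<otimes> \<psi> \<otimes> inv x"
      using word_value_conj[OF wsG x] ws by simp
    also have "word_value G ?vs = y \<otimes> inv \<psi> \<otimes> inv y"
      using wsG ws y word_value_inv[OF wsG] by (subst word_value_conj) auto
    finally have "word_value G (?us @ ?vs) = \<phi> ?n" using eq by simp
    then have "word_length G S (\<phi> ?n) \<le> enat (length (?us @ ?vs))"
      unfolding word_length_def using us vs by (intro INF_lower) (simp add: lists_eq_set del: map_map)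
    then show False using \<phi>(2)[of ?n] by simp
  qed
qed


section \<open>Homomorphisms and generated subalgebras\<close>

lemma alg_hom_interp:
  assumes "h \<in> alg_hom Sig A A'" "f \<in> symbols Sig" "xs \<in> arguments Sig f (universe A)"
  shows "h (interp A f xs) = interp A' f (map h xs)"
  using assms by (simp add: alg_hom_def)

lemma subalgebra_generated_subset:
  assumes "is_algebra Sig A" "X \<subseteq> universe A"
  shows "subalgebra_generated Sig A X \<subseteq> universe A"
proof
  fix x assume "x \<in> subalgebra_generated Sig A X"
  then show "x \<in> universe A"
    by induction (use assms in \<open>auto simp: is_algebra_def arguments_def in_lists_conv_set\<close>)
qed

lemma subalgebra_generated_least:
  assumes "X \<subseteq> subalgebra_generated Sig A Y"
  shows "subalgebra_generated Sig A X \<subseteq> subalgebra_generated Sig A Y"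
proof
  fix x assume "x \<in> subalgebra_generated Sig A X"
  then show "x \<in> subalgebra_generated Sig A Y"
    by induction (use assms in \<open>auto intro: subalgebra_generated.intros\<close>)
qed

lemma subalgebra_generated_mono:
  "X \<subseteq> Y \<Longrightarrow> subalgebra_generated Sig A X \<subseteq> subalgebra_generated Sig A Y"
  by (intro subalgebra_generated_least) (auto intro: subalgebra_generated.incl)

text \<open>
  Operations have finite arity, so an element of a generated subalgebra involves only finitely
  many generators. This keeps the domain of an automorphism as small as its support.
\<close>

lemma subalgebra_generated_finite:
  assumes "x \<in> subalgebra_generated Sig A X"
  shows "\<exists>Y\<subseteq>X. finite Y \<and> x \<in> subalgebra_generated Sig A Y"
  using assms
proof induction
  case (incl x)
  then show ?case by (intro exI[of _ "{x}"]) (auto intro: subalgebra_generated.incl)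
next
  case (app f xs)
  then have "\<forall>x\<in>set xs. \<exists>Y\<subseteq>X. finite Y \<and> x \<in> subalgebra_generated Sig A Y" by blast
  then obtain Y where Y: "\<And>x. x \<in> set xs \<Longrightarrow> Y x \<subseteq> X \<and> finite (Y x) \<and> x \<in> subalgebra_generated Sig A (Y x)"
    by metis
  let ?Y = "\<Union>x\<in>set xs. Y x"
  have "x \<in> subalgebra_generated Sig A ?Y" if "x \<in> set xs" for x
    using Y[OF that] subalgebra_generated_mono[of "Y x" ?Y] that by blast
  then have "interp A f xs \<in> subalgebra_generated Sig A ?Y"
    using app by (intro subalgebra_generated.app) auto
  then show ?case using Y by (intro exI[of _ ?Y]) auto
qed

lemma hom_eq_on_generated:
  assumes A: "is_algebra Sig A" and X: "X \<subseteq> universe A"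
    and h: "h \<in> alg_hom Sig A A'" and k: "k \<in> alg_hom Sig A A'"
    and eq: "\<And>x. x \<in> X \<Longrightarrow> h x = k x" and x: "x \<in> subalgebra_generated Sig A X"
  shows "h x = k x"
  using x
proof induction
  case (app f xs)
  then have "set xs \<subseteq> universe A" using subalgebra_generated_subset[OF A X] by blast
  then have "xs \<in> arguments Sig f (universe A)"
    using app by (auto simp: arguments_def in_lists_conv_set)
  moreover have "map h xs = map k xs" using app by simp
  ultimately show ?case using alg_hom_interp[OF h app(1)] alg_hom_interp[OF k app(1)] by metis
qed (use eq in auto)

lemma hom_image_generated:
  assumes A: "is_algebra Sig A" and X: "X \<subseteq> universe A" and h: "h \<in> alg_hom Sig A A'"
  shows "h ` subalgebra_generated Sig A X = subalgebra_generated Sig A' (h ` X)"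
proof
  have args: "xs \<in> arguments Sig f (universe A)"
    if "set xs \<subseteq> subalgebra_generated Sig A X" "length xs = arity Sig f" for xs f
    using that subalgebra_generated_subset[OF A X] by (auto simp: arguments_def in_lists_conv_set)
  show "h ` subalgebra_generated Sig A X \<subseteq> subalgebra_generated Sig A' (h ` X)"
  proof clarify
    fix x assume "x \<in> subalgebra_generated Sig A X"
    then show "h x \<in> subalgebra_generated Sig A' (h ` X)"
    proof induction
      case (app f xs)
      then have "h (interp A f xs) = interp A' f (map h xs)"
        using alg_hom_interp[OF h app(1)] args[of xs f] by auto
      moreover have "interp A' f (map h xs) \<in> subalgebra_generated Sig A' (h ` X)"
        using app by (intro subalgebra_generated.app) auto
      ultimately show ?case by simp
    qed (auto intro: subalgebra_generated.incl)
  qed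
  show "subalgebra_generated Sig A' (h ` X) \<subseteq> h ` subalgebra_generated Sig A X"
  proof
    fix y assume "y \<in> subalgebra_generated Sig A' (h ` X)"
    then show "y \<in> h ` subalgebra_generated Sig A X"
    proof induction
      case (app f ys)
      then have "ys \<in> lists (h ` subalgebra_generated Sig A X)" by (auto simp: in_lists_conv_set)
      then obtain xs where xs: "ys = map h xs" "set xs \<subseteq> subalgebra_generated Sig A X"
        unfolding lists_image by (auto simp: in_lists_conv_set)
      then have "interp A' f ys = h (interp A f xs)"
        using alg_hom_interp[OF h app(1)] app args[of xs f] by auto
      moreover have "interp A f xs \<in> subalgebra_generated Sig A X"
        using app xs by (auto intro: subalgebra_generated.app)
      ultimately show ?case by blast
    qed (auto intro: subalgebra_generated.incl)
  qed
qed


section \<open>Automorphisms of a free algebra\<close>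

locale free_algebra =
  fixes Sig :: "'f signature" and E :: "'f identities"
    and F :: "('f, 'a) universal_algebra" and B :: "'a set"
  assumes identities: "is_identities Sig E" and free: "free_basis Sig E F B"
begin

abbreviation U where "U \<equiv> universe F"
abbreviation gen where "gen \<equiv> subalgebra_generated Sig F"

lemma algebra: "is_algebra Sig F" and variety: "in_variety Sig E F"
  and basis_subset: "B \<subseteq> U" and gen_basis: "gen B = U"
  using free by (auto simp: free_basis_def in_variety_def)

lemmas gen_subset = subalgebra_generated_subset[OF algebra]
  and hom_eq = hom_eq_on_generated[OF algebra]
  and hom_image = hom_image_generated[OF algebra]

lemma auto_hom: "\<phi> \<in> alg_auto Sig F \<Longrightarrow> \<phi> \<in> alg_hom Sig F F"
  by (simp add: alg_auto_def)

lemma hom_closed: "h \<in> alg_hom Sig F F \<Longrightarrow> x \<in> U \<Longrightarrow> h x \<in> U"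
  by (auto simp: alg_hom_def)

lemma hom_compose:
  assumes h: "h \<in> alg_hom Sig F F" and k: "k \<in> alg_hom Sig F F"
  shows "h \<circ> k \<in> alg_hom Sig F F"
proof -
  have "map k xs \<in> arguments Sig f U" if "xs \<in> arguments Sig f U" for f xs
    using that hom_closed[OF k] by (auto simp: arguments_def in_lists_conv_set)
  then have "(h \<circ> k) (interp F f xs) = interp F f (map (h \<circ> k) xs)"
    if "f \<in> symbols Sig" "xs \<in> arguments Sig f U" for f xs
    using that by (simp add: alg_hom_interp[OF h] alg_hom_interp[OF k])
  then show ?thesis using hom_closed[OF h] hom_closed[OF k] by (auto simp: alg_hom_def)
qed

lemma hom_id: "id \<in> alg_hom Sig F F"
  by (simp add: alg_hom_def)

lemma hom_fixes:
  assumes X: "X \<subseteq> U" and h: "h \<in> alg_hom Sig F F" and id_on: "\<And>x. x \<in> X \<Longrightarrow> h x = x"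
    and y: "y \<in> gen X"
  shows "h y = y"
  using hom_eq[OF X h hom_id _ y] id_on by simp

lemma auto_eqI:
  assumes "\<phi> \<in> alg_auto Sig F" "\<psi> \<in> alg_auto Sig F" "\<And>b. b \<in> B \<Longrightarrow> \<phi> b = \<psi> b"
  shows "\<phi> = \<psi>"
proof (rule extensionalityI[of _ U])
  show "\<phi> \<in> extensional U" "\<psi> \<in> extensional U" using assms by (auto simp: alg_auto_def Bij_def)
  show "\<phi> x = \<psi> x" if "x \<in> U" for x
    using hom_eq[OF basis_subset auto_hom auto_hom] assms that gen_basis by metis
qed

lemma auto_inverse:
  assumes "\<phi> \<in> alg_auto Sig F"
  shows "\<exists>\<eta>\<in>alg_auto Sig F. \<forall>x\<in>U. \<eta> (\<phi> x) = x \<and> \<phi> (\<eta> x) = x"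
proof -
  have B: "\<phi> \<in> Bij U" using assms by (simp add: alg_auto_def)
  then have bij: "bij_betw \<phi> U U" by (simp add: Bij_def)
  have "inv\<^bsub>BijGroup U\<^esub> \<phi> \<in> alg_auto Sig F"
    using subgroup.m_inv_closed[OF subgroup_alg_auto[OF algebra] assms] .
  then have "(\<lambda>x\<in>U. inv_into U \<phi> x) \<in> alg_auto Sig F" using inv_BijGroup[OF B] by simp
  moreover have "\<phi> x \<in> U" "inv_into U \<phi> (\<phi> x) = x" "\<phi> (inv_into U \<phi> x) = x" if "x \<in> U" for x
    using bij that by (auto simp: bij_betw_def f_inv_into_f)
  ultimately show ?thesis by (intro bexI[of _ "\<lambda>x\<in>U. inv_into U \<phi> x"]) auto
qed

lemma endo_exists:
  assumes "u ` B \<subseteq> U"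
  shows "\<exists>h\<in>alg_hom Sig F F \<inter> extensional U. \<forall>b\<in>B. h b = u b"
proof -
  obtain h where h: "h \<in> alg_hom Sig F F" "\<forall>b\<in>B. h b = u b"
    using free_basis_extends[OF free identities variety assms] by blast
  have "map (restrict h U) xs = map h xs" if "xs \<in> arguments Sig f U" for f xs
    using that by (auto simp: arguments_def in_lists_conv_set)
  then have "restrict h U \<in> alg_hom Sig F F"
    using h(1) algebra unfolding alg_hom_def is_algebra_def by (auto simp del: map_eq_conv)
  then show ?thesis using h(2) basis_subset by (intro bexI[of _ "restrict h U"]) auto
qed

text \<open>
  Both composites are endomorphisms that fix the basis, so they are the identity.
\<close>

lemma auto_of_inverse_pair:
  assumes h: "h \<in> alg_hom Sig F F" "h \<in> extensional U" and k: "k \<in> alg_hom Sig F F"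
    and hk: "\<And>b. b \<in> B \<Longrightarrow> h (k b) = b" and kh: "\<And>b. b \<in> B \<Longrightarrow> k (h b) = b"
  shows "h \<in> alg_auto Sig F"
proof -
  have "(h \<circ> k) x = id x" if "x \<in> gen B" for x
    by (rule hom_eq[OF basis_subset hom_compose[OF h(1) k] hom_id _ that]) (simp add: hk)
  moreover have "(k \<circ> h) x = id x" if "x \<in> gen B" for x
    by (rule hom_eq[OF basis_subset hom_compose[OF k h(1)] hom_id _ that]) (simp add: kh)
  ultimately have "bij_betw h U U"
    using hom_closed[OF h(1)] hom_closed[OF k] gen_basis
    by (intro bij_betw_byWitness[of _ k]) auto
  then show ?thesis using h by (simp add: alg_auto_def Bij_def)
qed

lemma permutation_extends:
  assumes "\<And>b. b \<in> B \<Longrightarrow> \<sigma> b \<in> B \<and> \<tau> (\<sigma> b) = b" "\<And>b. b \<in> B \<Longrightarrow> \<tau> b \<in> B \<and> \<sigma> (\<tau> b) = b"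
  shows "\<exists>g\<in>alg_auto Sig F. \<forall>b\<in>B. g b = \<sigma> b"
proof -
  have "\<sigma> ` B \<subseteq> U" "\<tau> ` B \<subseteq> U" using assms basis_subset by auto
  then obtain h k where "h \<in> alg_hom Sig F F" "h \<in> extensional U" "\<forall>b\<in>B. h b = \<sigma> b"
    "k \<in> alg_hom Sig F F" "\<forall>b\<in>B. k b = \<tau> b"
    using endo_exists by (metis IntE)
  then show ?thesis using assms by (intro bexI[of _ h] auto_of_inverse_pair[of h k]) auto
qed

text \<open>
  That \<open>\<phi>\<close> moves only basis elements in \<open>X\<close> says nothing about where it sends them. The last
  clause demands equality rather than inclusion, so that the inverse of \<open>\<phi>\<close> preserves \<open>gen X\<close>
  too.
\<close>

definition lives_on :: "'a set \<Rightarrow> ('a \<Rightarrow> 'a) \<Rightarrow> bool" where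
  "lives_on X \<phi> \<longleftrightarrow> \<phi> \<in> alg_auto Sig F \<and> (\<forall>b\<in>B - X. \<phi> b = b) \<and> \<phi> ` gen X = gen X"

lemma lives_on_fixes:
  assumes "lives_on X \<phi>" "Y \<subseteq> B - X" "y \<in> gen Y"
  shows "\<phi> y = y"
proof -
  show ?thesis
    by (rule hom_fixes[OF _ _ _ assms(3)])
      (use assms basis_subset in \<open>auto simp: lives_on_def auto_hom\<close>)
qed

text \<open>
  Freeness yields an endomorphism that is \<open>\<theta> i\<close> on each \<open>D i\<close>, hence on all of \<open>gen (D i)\<close>.
  The inverses of the \<open>\<theta> i\<close> glue in the same way, and since each \<open>\<theta> i\<close> preserves \<open>gen (D i)\<close>
  the two endomorphisms are inverse to each other block by block.
\<close>

lemma glue: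
  fixes D :: "'i \<Rightarrow> 'a set"
  assumes D: "\<And>i. i \<in> K \<Longrightarrow> D i \<subseteq> B" and disj: "\<And>i j. i \<in> K \<Longrightarrow> j \<in> K \<Longrightarrow> i \<noteq> j \<Longrightarrow> D i \<inter> D j = {}"
    and \<theta>: "\<And>i. i \<in> K \<Longrightarrow> lives_on (D i) (\<theta> i)"
  shows "\<exists>\<psi>\<in>alg_auto Sig F. (\<forall>i\<in>K. \<forall>b\<in>D i. \<psi> b = \<theta> i b) \<and> (\<forall>b\<in>B - (\<Union>i\<in>K. D i). \<psi> b = b)"
proof -
  have "\<exists>\<eta>. \<forall>i\<in>K. \<eta> i \<in> alg_auto Sig F \<and> (\<forall>x\<in>U. \<eta> i (\<theta> i x) = x \<and> \<theta> i (\<eta> i x) = x)"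
    using \<theta> auto_inverse unfolding lives_on_def by (intro bchoice) blast
  then obtain \<eta> where \<eta>: "\<And>i. i \<in> K \<Longrightarrow> \<eta> i \<in> alg_auto Sig F"
    and inv: "\<And>i x. i \<in> K \<Longrightarrow> x \<in> U \<Longrightarrow> \<eta> i (\<theta> i x) = x \<and> \<theta> i (\<eta> i x) = x" by blast
  have DU: "D i \<subseteq> U" if "i \<in> K" for i using D[OF that] basis_subset by blast
  have \<theta>g: "\<theta> i x \<in> gen (D i)" and \<eta>g: "\<eta> i x \<in> gen (D i)" if i: "i \<in> K" and x: "x \<in> gen (D i)" for i x
  proof -
    have im: "\<theta> i ` gen (D i) = gen (D i)" using \<theta>[OF i] by (simp add: lives_on_def)
    then show "\<theta> i x \<in> gen (D i)" using x by blast
    from im x obtain y where "y \<in> gen (D i)" "x = \<theta> i y" by blast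
    then show "\<eta> i x \<in> gen (D i)" using inv[OF i] gen_subset[OF DU[OF i]] by auto
  qed
  define merge where "merge \<rho> b = (if \<exists>i\<in>K. b \<in> D i then \<rho> (THE i. i \<in> K \<and> b \<in> D i) b else b)"
    for \<rho> :: "'i \<Rightarrow> 'a \<Rightarrow> 'a" and b
  have merge: "merge \<rho> b = \<rho> i b" if "i \<in> K" "b \<in> D i" for \<rho> i b
  proof -
    have "(THE i. i \<in> K \<and> b \<in> D i) = i"
      using that disj by (intro the_equality) auto
    then show ?thesis using that by (auto simp: merge_def)
  qed
  have merge_id: "merge \<rho> b = b" if "b \<in> B - (\<Union>i\<in>K. D i)" for \<rho> b
    using that by (auto simp: merge_def)
  have gD: "b \<in> gen (D i)" if "b \<in> D i" for b i using that by (rule subalgebra_generated.incl)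
  have closed: "merge \<theta> ` B \<subseteq> U" "merge \<eta> ` B \<subseteq> U"
  proof safe
    fix b assume b: "b \<in> B"
    have "merge \<theta> b \<in> U \<and> merge \<eta> b \<in> U"
    proof (cases "\<exists>i\<in>K. b \<in> D i")
      case True
      then obtain i where i: "i \<in> K" "b \<in> D i" by blast
      then show ?thesis
        using merge[OF i] \<theta>g[OF i(1) gD] \<eta>g[OF i(1) gD] gen_subset[OF DU[OF i(1)]] by (simp add: subset_iff)
    next
      case False
      then show ?thesis using b basis_subset by (auto simp: merge_def)
    qed
    then show "merge \<theta> b \<in> U" "merge \<eta> b \<in> U" by auto
  qed
  from endo_exists[OF closed(1)] endo_exists[OF closed(2)] obtain h k
    where h: "h \<in> alg_hom Sig F F" "h \<in> extensional U" "\<And>b. b \<in> B \<Longrightarrow> h b = merge \<theta> b"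
      and k: "k \<in> alg_hom Sig F F" "\<And>b. b \<in> B \<Longrightarrow> k b = merge \<eta> b" by blast
  have h\<theta>: "h x = \<theta> i x" and k\<eta>: "k x = \<eta> i x" if i: "i \<in> K" and x: "x \<in> gen (D i)" for i x
  proof -
    have hom: "\<theta> i \<in> alg_hom Sig F F" "\<eta> i \<in> alg_hom Sig F F"
      using \<theta>[OF i] \<eta>[OF i] by (auto simp: lives_on_def auto_hom)
    have "h b = \<theta> i b" "k b = \<eta> i b" if "b \<in> D i" for b
      using h(3)[of b] k(2)[of b] D[OF i] merge[OF i that] that by auto
    then show "h x = \<theta> i x" "k x = \<eta> i x"
      by (auto intro: hom_eq[OF DU[OF i] h(1) hom(1) _ x] hom_eq[OF DU[OF i] k(1) hom(2) _ x])
  qed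
  have inverse: "h (k b) = b \<and> k (h b) = b" if b: "b \<in> B" for b
  proof (cases "\<exists>i\<in>K. b \<in> D i")
    case True
    then obtain i where i: "i \<in> K" "b \<in> D i" by blast
    then have "h b = \<theta> i b" "k b = \<eta> i b" "h (\<eta> i b) = \<theta> i (\<eta> i b)" "k (\<theta> i b) = \<eta> i (\<theta> i b)"
      by (simp_all add: h\<theta> k\<eta> \<theta>g \<eta>g gD)
    then show ?thesis using inv[OF i(1), of b] b basis_subset by auto
  next
    case False
    then show ?thesis using b h(3) k(2) merge_id by auto
  qed
  then have auto: "h \<in> alg_auto Sig F" by (intro auto_of_inverse_pair[OF h(1,2) k(1)]) auto
  have "\<forall>i\<in>K. \<forall>b\<in>D i. h b = \<theta> i b" using h\<theta> gD by blast
  moreover have "\<forall>b\<in>B - (\<Union>i\<in>K. D i). h b = b" using h(3) merge_id by simp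
  ultimately show ?thesis by (intro bexI[OF _ auto] conjI)
qed

end


section \<open>Automorphisms of bounded support\<close>

text \<open>
  The hypothesis says that \<open>t \<phi> t\<inverse>\<close> is the commutator \<open>\<psi> g \<psi>\<inverse> g\<inverse>\<close>, which is \<open>\<psi>\<close> times a
  conjugate of \<open>\<psi>\<inverse>\<close>.
\<close>

lemma (in group) conjugated_commutator:
  assumes "t \<in> carrier G" "\<phi> \<in> carrier G" "\<psi> \<in> carrier G" "g \<in> carrier G"
    and "\<psi> \<otimes> g = (t \<otimes> \<phi> \<otimes> inv t) \<otimes> (g \<otimes> \<psi>)"
  shows "\<phi> = (inv t \<otimes> \<psi> \<otimes> inv (inv t)) \<otimes> ((inv t \<otimes> g) \<otimes> inv \<psi> \<otimes> inv (inv t \<otimes> g))"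
proof -
  have cancel: "a \<otimes> (inv a \<otimes> b) = b" "inv a \<otimes> (a \<otimes> b) = b"
    if "a \<in> carrier G" "b \<in> carrier G" for a b
    using that by (simp_all flip: m_assoc)
  have "(inv t \<otimes> \<psi> \<otimes> inv (inv t)) \<otimes> ((inv t \<otimes> g) \<otimes> inv \<psi> \<otimes> inv (inv t \<otimes> g))
      = inv t \<otimes> (\<psi> \<otimes> g) \<otimes> inv \<psi> \<otimes> inv g \<otimes> t"
    using assms(1-4) by (simp add: m_assoc inv_mult_group cancel)
  also have "\<dots> = \<phi>"
    unfolding assms(5) using assms(1-4) by (simp add: m_assoc cancel)
  finally show ?thesis by simp
qed

locale bounded_support = free_algebra Sig E F B
  for Sig :: "'f signature" and E :: "'f identities"
    and F :: "('f, 'a) universal_algebra" and B :: "'a set" +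
  fixes lam :: "'c rel"
  assumes lam: "Cinfinite lam" and lam_less: "lam <o |B|"
begin

abbreviation G where "G \<equiv> Aut_le lam B Sig F"

lemma group_G: "group G"
  using subgroup.subgroup_is_group[OF subgroup_Aut_le[OF algebra basis_subset lam] group_Aut[OF algebra]]
  by (simp add: Aut_le_def)

interpretation G: group G by (rule group_G)

lemma carrier_G: "\<phi> \<in> carrier G \<longleftrightarrow> \<phi> \<in> alg_auto Sig F \<and> |supp B \<phi>| \<le>o lam"
  by (simp add: Aut_le_def Aut_def)

lemma G_hom: "\<phi> \<in> carrier G \<Longrightarrow> \<phi> \<in> alg_hom Sig F F"
  by (simp add: carrier_G auto_hom)

lemma G_closed: "\<phi> \<in> carrier G \<Longrightarrow> x \<in> U \<Longrightarrow> \<phi> x \<in> U"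
  by (rule hom_closed[OF G_hom])

lemma mult_apply:
  "\<phi> \<in> carrier G \<Longrightarrow> \<psi> \<in> carrier G \<Longrightarrow> x \<in> U \<Longrightarrow> (\<phi> \<otimes>\<^bsub>G\<^esub> \<psi>) x = \<phi> (\<psi> x)"
  by (simp add: Aut_le_def Aut_def BijGroup_def compose_def alg_auto_def)

lemma one_apply: "x \<in> U \<Longrightarrow> \<one>\<^bsub>G\<^esub> x = x"
  by (simp add: Aut_le_def Aut_def BijGroup_def)

lemma inv_apply:
  assumes "\<phi> \<in> carrier G" "x \<in> U"
  shows "(inv\<^bsub>G\<^esub> \<phi>) (\<phi> x) = x" "\<phi> ((inv\<^bsub>G\<^esub> \<phi>) x) = x"
  using assms mult_apply[of "inv\<^bsub>G\<^esub> \<phi>" \<phi> x] mult_apply[of \<phi> "inv\<^bsub>G\<^esub> \<phi>" x] one_apply by simp_all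

lemma permutation_in_G:
  assumes "\<And>b. b \<in> B \<Longrightarrow> \<sigma> b \<in> B \<and> \<tau> (\<sigma> b) = b" "\<And>b. b \<in> B \<Longrightarrow> \<tau> b \<in> B \<and> \<sigma> (\<tau> b) = b"
    and S: "\<And>b. b \<in> B - S \<Longrightarrow> \<sigma> b = b" and "|S| \<le>o lam"
  shows "\<exists>g\<in>carrier G. \<forall>b\<in>B. g b = \<sigma> b"
proof -
  obtain g where g: "g \<in> alg_auto Sig F" "\<forall>b\<in>B. g b = \<sigma> b"
    using permutation_extends[of \<sigma> \<tau>] assms(1,2) by blast
  then have "supp B g \<subseteq> S" using S unfolding supp_def by fastforce
  then have "|supp B g| \<le>o lam" using card_of_mono1 \<open>|S| \<le>o lam\<close> ordLeq_transitive by blast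
  then show ?thesis using g carrier_G by blast
qed

lemma lives_on_conj:
  assumes \<phi>: "\<phi> \<in> carrier G" "lives_on C \<phi>" and C: "C \<subseteq> B" and t: "t \<in> carrier G" "t ` B = B"
  shows "lives_on (t ` C) (t \<otimes>\<^bsub>G\<^esub> \<phi> \<otimes>\<^bsub>G\<^esub> inv\<^bsub>G\<^esub> t)"
proof -
  let ?\<theta> = "t \<otimes>\<^bsub>G\<^esub> \<phi> \<otimes>\<^bsub>G\<^esub> inv\<^bsub>G\<^esub> t"
  have conj: "?\<theta> (t x) = t (\<phi> x)" if "x \<in> U" for x
    using that \<phi> t by (simp add: mult_apply G_closed inv_apply)
  have CU: "C \<subseteq> U" using C basis_subset by blast
  have "?\<theta> b = b" if b: "b \<in> B - t ` C" for b
  proof -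
    obtain b' where b': "b' \<in> B - C" "b = t b'" using b t(2) by blast
    then have "\<phi> b' = b'" using \<phi>(2) by (simp add: lives_on_def)
    then show ?thesis using conj[of b'] b' basis_subset by auto
  qed
  moreover have "?\<theta> ` gen (t ` C) = gen (t ` C)"
  proof -
    have "?\<theta> ` t ` gen C = t ` \<phi> ` gen C"
      unfolding image_image using conj gen_subset[OF CU] by (intro image_cong) auto
    also have "\<phi> ` gen C = gen C" using \<phi>(2) by (simp add: lives_on_def)
    finally show ?thesis by (simp add: hom_image[OF CU G_hom[OF t(1)]])
  qed
  moreover have "?\<theta> \<in> alg_auto Sig F" using \<phi>(1) t(1) carrier_G by blast
  ultimately show ?thesis by (simp add: lives_on_def)
qed

lemma finite_le_lam: "finite A \<Longrightarrow> |A| \<le>o lam"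
  using ordLeq_transitive[OF ordLess_imp_ordLeq natLeq_ordLeq_cinfinite[OF lam]]
  by (simp add: finite_iff_ordLess_natLeq)

lemma countable_le_lam: "|A :: 'i :: countable set| \<le>o lam"
proof -
  have "|A| \<le>o |UNIV :: nat set|"
    by (rule card_of_ordLeqI[of to_nat]) auto
  also have "|UNIV :: nat set| =o natLeq" by (rule card_of_nat)
  also have "natLeq \<le>o lam" by (rule natLeq_ordLeq_cinfinite[OF lam])
  finally show ?thesis .
qed

text \<open>
  The supports together with the finitely many generators needed to express the images of their
  elements under \<open>\<phi> n\<close> and its inverse make up \<open>C\<close>. One step is enough: an element of \<open>C\<close> outside
  the support of \<open>\<phi> n\<close> is fixed by \<open>\<phi> n\<close> and by its inverse.
\<close>

lemma common_domain:
  assumes \<phi>: "\<And>n :: nat. \<phi> n \<in> carrier G"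
  shows "\<exists>C\<subseteq>B. |C| \<le>o lam \<and> (\<forall>n. lives_on C (\<phi> n))"
proof -
  define \<eta> where "\<eta> n = inv\<^bsub>G\<^esub> (\<phi> n)" for n
  have \<eta>: "\<eta> n \<in> carrier G" for n using \<phi> by (simp add: \<eta>_def)
  have "\<exists>Y\<subseteq>B. finite Y \<and> x \<in> gen Y" if "x \<in> U" for x
    using subalgebra_generated_finite[of x Sig F B] that gen_basis by simp
  then obtain Y where Y: "\<And>x. x \<in> U \<Longrightarrow> Y x \<subseteq> B \<and> finite (Y x) \<and> x \<in> gen (Y x)" by metis
  define C where "C = (\<Union>n. \<Union>b\<in>supp B (\<phi> n). insert b (Y (\<phi> n b) \<union> Y (\<eta> n b)))"
  have suppU: "b \<in> B \<and> b \<in> U" if "b \<in> supp B (\<phi> n)" for b n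
    using that basis_subset by (auto simp: supp_def)
  have YY: "Y (\<phi> n b) \<subseteq> B \<and> finite (Y (\<phi> n b))" "Y (\<eta> n b) \<subseteq> B \<and> finite (Y (\<eta> n b))"
    if "b \<in> supp B (\<phi> n)" for b n
    using Y[OF G_closed[OF \<phi>]] Y[OF G_closed[OF \<eta>]] suppU[OF that] by auto
  then have CB: "C \<subseteq> B" using suppU unfolding C_def by blast
  then have CU: "C \<subseteq> U" using basis_subset by blast
  have card: "|C| \<le>o lam"
    unfolding C_def
  proof (intro UNION_Cinfinite_bound ballI lam countable_le_lam)
    show "|supp B (\<phi> n)| \<le>o lam" for n using \<phi> by (simp add: carrier_G)
    show "|insert b (Y (\<phi> n b) \<union> Y (\<eta> n b))| \<le>o lam" if "b \<in> supp B (\<phi> n)" for b n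
      using YY[OF that] by (intro finite_le_lam) simp
  qed
  have into: "\<phi> n c \<in> gen C \<and> \<eta> n c \<in> gen C" if c: "c \<in> C" for n c
  proof (cases "\<phi> n c = c")
    case True
    then have "\<eta> n c = c" using inv_apply(1)[OF \<phi>, of c n] c CU by (auto simp: \<eta>_def)
    then show ?thesis using True c by (simp add: subalgebra_generated.incl)
  next
    case False
    then have c': "c \<in> supp B (\<phi> n)" using c CB by (auto simp: supp_def)
    then have "Y (\<phi> n c) \<subseteq> C" "Y (\<eta> n c) \<subseteq> C" unfolding C_def by blast+
    moreover have "\<phi> n c \<in> gen (Y (\<phi> n c))" "\<eta> n c \<in> gen (Y (\<eta> n c))"
      using Y[OF G_closed[OF \<phi>]] Y[OF G_closed[OF \<eta>]] suppU[OF c'] by auto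
    ultimately show ?thesis using subalgebra_generated_mono[of _ C Sig F] by blast
  qed
  have "lives_on C (\<phi> n)" for n
    unfolding lives_on_def
  proof (intro conjI ballI)
    show "\<phi> n \<in> alg_auto Sig F" using \<phi> carrier_G by blast
    show "\<phi> n b = b" if "b \<in> B - C" for b
      using that unfolding C_def supp_def by blast
    have sub: "\<rho> ` gen C \<subseteq> gen C" if "\<rho> \<in> carrier G" "\<rho> ` C \<subseteq> gen C" for \<rho>
      using subalgebra_generated_least[OF that(2)] hom_image[OF CU G_hom[OF that(1)]] by simp
    have "\<phi> n ` C \<subseteq> gen C" "\<eta> n ` C \<subseteq> gen C" using into by auto
    then have "\<phi> n ` gen C \<subseteq> gen C" "\<eta> n ` gen C \<subseteq> gen C" using sub \<phi> \<eta> by auto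
    moreover have "\<phi> n (\<eta> n x) = x" if "x \<in> gen C" for x
      unfolding \<eta>_def using inv_apply(2)[OF \<phi>] gen_subset[OF CU] that by blast
    ultimately show "\<phi> n ` gen C = gen C" by force
  qed
  then show ?thesis using CB card by blast
qed

text \<open>
  Removing at most \<open>\<lambda>\<close> elements from \<open>B\<close> leaves more than \<open>\<lambda>\<close> of them, and countably many
  copies of \<open>C\<close> take up at most \<open>\<lambda>\<close>.
\<close>

lemma disjoint_copies:
  assumes C: "C \<subseteq> B" "|C| \<le>o lam"
  shows "\<exists>j. inj_on j (C \<times> (UNIV :: 'i :: countable set)) \<and> j ` (C \<times> UNIV) \<subseteq> B - C \<and>
    |j ` (C \<times> UNIV)| \<le>o lam"
proof -
  have "\<not> |B - C| \<le>o lam"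
  proof
    assume "|B - C| \<le>o lam"
    then have "|C \<union> (B - C)| \<le>o lam" using C lam by (intro Un_Cinfinite_bound)
    moreover have "C \<union> (B - C) = B" using C by blast
    ultimately show False using lam_less not_ordLess_ordLeq by metis
  qed
  then have big: "lam \<le>o |B - C|"
    using lam by (meson card_of_Well_order card_order_on_well_order_on not_ordLeq_iff_ordLess ordLess_imp_ordLeq)
  have copies: "|C \<times> (UNIV :: 'i set)| \<le>o lam"
    using C lam countable_le_lam by (intro card_of_Times_ordLeq_infinite_Field) (auto simp: cinfinite_def)
  then have "|C \<times> (UNIV :: 'i set)| \<le>o |B - C|" using big by (rule ordLeq_transitive)
  then obtain j where "inj_on j (C \<times> (UNIV :: 'i set))" "j ` (C \<times> UNIV) \<subseteq> B - C"
    unfolding card_of_ordLeq[symmetric] by blast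
  moreover have "|j ` (C \<times> UNIV)| \<le>o lam" by (rule ordLeq_transitive[OF card_of_image copies])
  ultimately show ?thesis by blast
qed

section \<open>Absorbing a sequence of automorphisms\<close>

text \<open>
  Indexing the copies in a row by all integers makes the shift of a row a bijection, while \<open>\<psi>\<close>
  acts only on the copies with nonnegative index. The shift then drops the copy with
  index \<open>0\<close> and nothing else.
\<close>

lemma absorbing_automorphism:
  assumes \<phi>: "\<And>n :: nat. \<phi> n \<in> carrier G"
  shows "\<exists>\<psi>\<in>carrier G. \<forall>n. \<exists>t\<in>carrier G. \<exists>g\<in>carrier G.
    \<psi> \<otimes>\<^bsub>G\<^esub> g = (t \<otimes>\<^bsub>G\<^esub> \<phi> n \<otimes>\<^bsub>G\<^esub> inv\<^bsub>G\<^esub> t) \<otimes>\<^bsub>G\<^esub> (g \<otimes>\<^bsub>G\<^esub> \<psi>)"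
proof -
  obtain C where CB: "C \<subseteq> B" and C: "|C| \<le>o lam" and lives: "\<And>n. lives_on C (\<phi> n)"
    using common_domain[of \<phi>, OF \<phi>] by metis
  from disjoint_copies[OF CB C, where 'i = "nat \<times> int"] obtain j :: "'a \<times> (nat \<times> int) \<Rightarrow> 'a"
    where j: "inj_on j (C \<times> UNIV)" "j ` (C \<times> UNIV) \<subseteq> B - C" "|j ` (C \<times> UNIV)| \<le>o lam" by metis
  define D where "D i = (\<lambda>c. j (c, i)) ` C" for i
  have jB: "j (c, i) \<in> B" "j (c, i) \<notin> C" if "c \<in> C" for c i using j(2) that by auto
  have j_eq: "j (c, i) = j (c', i') \<longleftrightarrow> c = c' \<and> i = i'" if "c \<in> C" "c' \<in> C" for c c' i i'
    using inj_on_eq_iff[OF j(1), of "(c, i)" "(c', i')"] that by simp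
  have CU: "C \<subseteq> U" using CB basis_subset by blast
  have DB: "D i \<subseteq> B" for i unfolding D_def by (intro image_subsetI jB)
  have DU: "D i \<subseteq> U" for i using DB basis_subset by blast
  have D_disj: "D i \<inter> D i' = {}" if "i \<noteq> i'" for i i' using that j_eq unfolding D_def by blast
  have D_le: "|D i| \<le>o lam" for i
    using ordLeq_transitive[OF card_of_image C] by (simp add: D_def)

  \<comment> \<open>\<open>t i\<close> is induced by the involution of \<open>B\<close> that exchanges \<open>C\<close> with \<open>D i\<close>.\<close>
  have "\<exists>t\<in>carrier G. t ` B = B \<and> (\<forall>c\<in>C. t c = j (c, i))" for i
  proof -
    define \<sigma> where "\<sigma> b = (if b \<in> C then j (b, i)
      else if b \<in> D i then fst (inv_into (C \<times> UNIV) j b) else b)" for b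
    have fst_inv: "fst (inv_into (C \<times> UNIV) j (j (c, i))) = c" if "c \<in> C" for c
      using j(1) that by (simp add: inv_into_f_f)
    have \<sigma>C: "\<sigma> c = j (c, i)" "\<sigma> (j (c, i)) = c" if "c \<in> C" for c
      using that jB fst_inv by (auto simp: \<sigma>_def D_def)
    have \<sigma>_id: "\<sigma> b = b" if "b \<notin> C" "b \<notin> D i" for b using that by (simp add: \<sigma>_def)
    have \<sigma>: "\<sigma> b \<in> B \<and> \<sigma> (\<sigma> b) = b" if "b \<in> B" for b
    proof (cases "b \<in> C \<or> b \<in> D i")
      case True
      then obtain c where c: "c \<in> C" "b = c \<or> b = j (c, i)" by (auto simp: D_def)
      then show ?thesis using \<sigma>C[OF c(1)] jB(1)[OF c(1), of i] CB by auto
    qed (use that \<sigma>_id in auto)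
    have "|C \<union> D i| \<le>o lam" using C D_le lam by (intro Un_Cinfinite_bound)
    then obtain t where t: "t \<in> carrier G" "\<forall>b\<in>B. t b = \<sigma> b"
      using permutation_in_G[of \<sigma> \<sigma> "C \<union> D i"] \<sigma> \<sigma>_id by auto
    have "t ` B = \<sigma> ` B" using t(2) by (intro image_cong) auto
    also have "\<dots> = B" using \<sigma> by force
    finally show ?thesis using t CB \<sigma>C by (intro bexI[of _ t]) auto
  qed
  then obtain t where t: "\<And>i. t i \<in> carrier G" "\<And>i. t i ` B = B" and tC: "\<And>i c. c \<in> C \<Longrightarrow> t i c = j (c, i)"
    by metis
  have t_im: "t i ` C = D i" for i using tC by (auto simp: D_def)

  define \<theta> where "\<theta> i = t i \<otimes>\<^bsub>G\<^esub> \<phi> (fst i) \<otimes>\<^bsub>G\<^esub> inv\<^bsub>G\<^esub> (t i)" for i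
  have \<theta>G: "\<theta> i \<in> carrier G" for i using \<phi> t by (simp add: \<theta>_def)
  have \<theta>_lives: "lives_on (D i) (\<theta> i)" for i
    using lives_on_conj[OF \<phi> lives CB t] by (simp add: \<theta>_def t_im)
  have \<theta>j: "\<theta> i (j (c, i)) = t i (\<phi> (fst i) c)" if "c \<in> C" for i c
    using that \<phi> t CU tC[OF that, of i, symmetric]
    by (auto simp: \<theta>_def mult_apply G_closed inv_apply subset_iff)
  have \<theta>_fixes: "\<theta> i x = x" if "x \<in> gen (D i')" "i \<noteq> i'" for i i' x
    using lives_on_fixes[OF \<theta>_lives _ that(1)] DB D_disj that(2) by blast
  have \<phi>C: "\<phi> n c \<in> gen C" if "c \<in> C" for n c
    using lives[of n] that subalgebra_generated.incl[of c C Sig F] unfolding lives_on_def by blast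

  define K :: "(nat \<times> int) set" where "K = {(m, k). k \<ge> 0}"
  have "\<exists>\<psi>\<in>alg_auto Sig F. (\<forall>i\<in>K. \<forall>b\<in>D i. \<psi> b = \<theta> i b) \<and> (\<forall>b\<in>B - (\<Union>i\<in>K. D i). \<psi> b = b)"
    by (rule glue[OF DB D_disj \<theta>_lives])
  then obtain \<psi> where \<psi>: "\<psi> \<in> alg_auto Sig F" "\<And>i b. i \<in> K \<Longrightarrow> b \<in> D i \<Longrightarrow> \<psi> b = \<theta> i b"
    and \<psi>_id: "\<And>b. b \<in> B - (\<Union>i\<in>K. D i) \<Longrightarrow> \<psi> b = b"
    by metis
  have "supp B \<psi> \<subseteq> j ` (C \<times> UNIV)"
    using \<psi>_id by (fastforce simp: supp_def D_def)
  then have "|supp B \<psi>| \<le>o lam" using card_of_mono1 j(3) ordLeq_transitive by blast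
  then have \<psi>G: "\<psi> \<in> carrier G" using \<psi>(1) carrier_G by blast
  have \<psi>j: "\<psi> (j (c, i)) = (if snd i \<ge> 0 then \<theta> i (j (c, i)) else j (c, i))" if c: "c \<in> C" for c i
  proof (cases "snd i \<ge> 0")
    case True
    then show ?thesis using \<psi>(2)[of i "j (c, i)"] c by (cases i) (auto simp: K_def D_def)
  next
    case False
    moreover have "j (c, i) \<in> D i' \<longleftrightarrow> i = i'" for i' using c j_eq unfolding D_def by blast
    ultimately have "j (c, i) \<notin> (\<Union>i\<in>K. D i)" by (auto simp: K_def)
    then show ?thesis using False \<psi>_id jB(1)[OF c] by simp
  qed
  have \<psi>_gen: "\<psi> b \<in> gen (D i)" if b: "b \<in> D i" for b i
  proof -
    obtain c where "c \<in> C" "b = j (c, i)" using b unfolding D_def by blast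
    then have eq: "\<psi> b = (if snd i \<ge> 0 then \<theta> i b else b)" using \<psi>j by blast
    have bg: "b \<in> gen (D i)" using b by (rule subalgebra_generated.incl)
    have "\<theta> i b \<in> gen (D i)" using \<theta>_lives[of i] bg unfolding lives_on_def by blast
    then show ?thesis using eq bg by simp
  qed

  have "\<exists>t\<in>carrier G. \<exists>g\<in>carrier G.
      \<psi> \<otimes>\<^bsub>G\<^esub> g = (t \<otimes>\<^bsub>G\<^esub> \<phi> n \<otimes>\<^bsub>G\<^esub> inv\<^bsub>G\<^esub> t) \<otimes>\<^bsub>G\<^esub> (g \<otimes>\<^bsub>G\<^esub> \<psi>)" for n
  proof -
    define row where "row = (\<Union>k. D (n, k))"
    define shift where "shift d b = (if b \<in> row
      then (case inv_into (C \<times> UNIV) j b of (c, m, k) \<Rightarrow> j (c, m, k + d)) else b)" for d :: int and b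
    have shift_j: "shift d (j (c, n, k)) = j (c, n, k + d)" if "c \<in> C" for d c k
      using that inv_into_f_f[OF j(1), of "(c, n, k)"] by (auto simp: shift_def row_def D_def)
    have shift_id: "shift d b = b" if "b \<notin> row" for d b using that by (simp add: shift_def)
    have inverse: "shift d b \<in> B \<and> shift (- d) (shift d b) = b" if b: "b \<in> B" for d b
    proof (cases "b \<in> row")
      case True
      then obtain c k where "c \<in> C" "b = j (c, n, k)" by (auto simp: row_def D_def)
      then show ?thesis using shift_j jB by simp
    qed (use b shift_id in auto)
    have "row \<subseteq> j ` (C \<times> UNIV)" by (auto simp: row_def D_def)
    then have "|row| \<le>o lam" using card_of_mono1 j(3) ordLeq_transitive by blast
    then obtain g where g: "g \<in> carrier G" "\<And>b. b \<in> B \<Longrightarrow> g b = shift 1 b"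
      using permutation_in_G[of "shift 1" "shift (- 1)" row] inverse[of _ 1]
        inverse[of _ "- 1"] shift_id by auto
    have gj: "g (j (c, n, k)) = j (c, n, k + 1)" if "c \<in> C" for c k
      using g(2) jB shift_j that by simp
    have g_id: "g b = b" if "b \<in> B" "b \<notin> row" for b using g(2) shift_id that by simp
    have g_fixes: "g x = x" if "x \<in> gen (D (m, k))" "m \<noteq> n" for m k x
    proof (rule hom_fixes[OF DU G_hom[OF g(1)] _ that(1)])
      fix b assume b: "b \<in> D (m, k)"
      have "b \<notin> row" using b D_disj[of "(m, k)"] that(2) unfolding row_def by blast
      then show "g b = b" using g_id b DB by blast
    qed
    \<comment> \<open>The shift carries each copy of \<open>\<phi> n\<close> to the next one, because both sides are
      homomorphisms that agree on \<open>C\<close>.\<close>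
    have gt: "g (t (n, k) x) = t (n, k + 1) x" if "x \<in> gen C" for k x
    proof -
      have "(g \<circ> t (n, k)) x = t (n, k + 1) x"
        using tC gj by (intro hom_eq[OF CU hom_compose[OF G_hom[OF g(1)] G_hom[OF t(1)]] G_hom[OF t(1)] _ that]) simp
      then show ?thesis by simp
    qed
    have "(\<psi> \<otimes>\<^bsub>G\<^esub> g) b = (\<theta> (n, 0) \<otimes>\<^bsub>G\<^esub> (g \<otimes>\<^bsub>G\<^esub> \<psi>)) b" if b: "b \<in> B" for b
    proof -
      have "\<psi> (g b) = \<theta> (n, 0) (g (\<psi> b))"
      proof (cases "b \<in> j ` (C \<times> UNIV)")
        case False
        then have "b \<notin> D i" for i by (auto simp: D_def)
        then show ?thesis
          using b \<psi>_id g_id \<theta>_lives[of "(n, 0)"] by (simp add: row_def lives_on_def)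
      next
        case True
        then obtain c m k where c: "c \<in> C" and b_eq: "b = j (c, m, k)" by auto
        then have bD: "b \<in> D (m, k)" by (auto simp: D_def)
        show ?thesis
        proof (cases "m = n")
          case False
          have "g b = b" by (rule g_fixes[OF subalgebra_generated.incl[OF bD] False])
          moreover have "g (\<psi> b) = \<psi> b" by (rule g_fixes[OF \<psi>_gen[OF bD] False])
          moreover have "\<theta> (n, 0) (\<psi> b) = \<psi> b"
            using \<theta>_fixes[OF \<psi>_gen[OF bD], of "(n, 0)"] False by simp
          ultimately show ?thesis by simp
        next
          case True
          have next_D: "j (c, n, k + 1) \<in> gen (D (n, k + 1))"
            using c by (auto simp: D_def intro: subalgebra_generated.incl)
          have gb: "g b = j (c, n, k + 1)" using gj c b_eq True by simp
          \<comment> \<open>At \<open>k = - 1\<close> the shift enters the block \<open>(n, 0)\<close>, where \<open>\<psi>\<close> is \<open>\<theta> (n, 0)\<close>. For all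
            other \<open>k\<close> the point \<open>g (\<psi> b)\<close> lies in a block that \<open>\<theta> (n, 0)\<close> fixes.\<close>
          consider "k \<ge> 0" | "k = - 1" | "k < - 1" by linarith
          then show ?thesis
          proof cases
            case 1
            have "t (n, k + 1) (\<phi> n c) \<in> t (n, k + 1) ` gen C" using \<phi>C[OF c] by blast
            also have "\<dots> = gen (D (n, k + 1))" by (simp add: hom_image[OF CU G_hom[OF t(1)]] t_im)
            finally have "\<theta> (n, 0) (t (n, k + 1) (\<phi> n c)) = t (n, k + 1) (\<phi> n c)"
              using 1 by (intro \<theta>_fixes) auto
            moreover have "\<psi> b = t (n, k) (\<phi> n c)" using \<psi>j[OF c] \<theta>j[OF c] b_eq True 1 by simp
            moreover have "\<psi> (g b) = t (n, k + 1) (\<phi> n c)" using \<psi>j[OF c] \<theta>j[OF c] gb 1 by simp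
            ultimately show ?thesis using gt[OF \<phi>C[OF c]] by simp
          next
            case 2
            then show ?thesis using \<psi>j[OF c] b_eq True gb by simp
          next
            case 3
            then have "\<theta> (n, 0) (j (c, n, k + 1)) = j (c, n, k + 1)"
              using next_D by (intro \<theta>_fixes) auto
            then show ?thesis using 3 \<psi>j[OF c] b_eq True gb by simp
          qed
        qed
      qed
      moreover have "b \<in> U" using b basis_subset by blast
      ultimately show ?thesis using \<theta>G \<psi>G g(1) by (simp add: mult_apply G_closed)
    qed
    then have "\<psi> \<otimes>\<^bsub>G\<^esub> g = \<theta> (n, 0) \<otimes>\<^bsub>G\<^esub> (g \<otimes>\<^bsub>G\<^esub> \<psi>)"
      using \<theta>G \<psi>G g(1) carrier_G G.m_closed by (intro auto_eqI) blast+
    then show ?thesis using t(1) g(1) by (intro bexI[of _ "t (n, 0)"] bexI[of _ g]) (simp_all add: \<theta>_def)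
  qed
  then show ?thesis using \<psi>G by blast
qed

lemma finite_C_width_G: "finite_C_width G"
proof (rule group.finite_C_widthI[OF group_G])
  fix \<phi> :: "nat \<Rightarrow> 'a \<Rightarrow> 'a" assume "range \<phi> \<subseteq> carrier G"
  then have \<phi>: "\<phi> n \<in> carrier G" for n by blast
  from absorbing_automorphism[of \<phi>, OF this] obtain \<psi> where \<psi>: "\<psi> \<in> carrier G"
    and abs: "\<And>n. \<exists>t\<in>carrier G. \<exists>g\<in>carrier G.
      \<psi> \<otimes>\<^bsub>G\<^esub> g = (t \<otimes>\<^bsub>G\<^esub> \<phi> n \<otimes>\<^bsub>G\<^esub> inv\<^bsub>G\<^esub> t) \<otimes>\<^bsub>G\<^esub> (g \<otimes>\<^bsub>G\<^esub> \<psi>)" by blast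
  show "\<exists>\<psi>\<in>carrier G. \<forall>n. \<exists>x\<in>carrier G. \<exists>y\<in>carrier G.
      \<phi> n = (x \<otimes>\<^bsub>G\<^esub> \<psi> \<otimes>\<^bsub>G\<^esub> inv\<^bsub>G\<^esub> x) \<otimes>\<^bsub>G\<^esub> (y \<otimes>\<^bsub>G\<^esub> inv\<^bsub>G\<^esub> \<psi> \<otimes>\<^bsub>G\<^esub> inv\<^bsub>G\<^esub> y)"
  proof (rule bexI[OF _ \<psi>], rule allI)
    fix n
    obtain t g where "t \<in> carrier G" "g \<in> carrier G"
      "\<psi> \<otimes>\<^bsub>G\<^esub> g = (t \<otimes>\<^bsub>G\<^esub> \<phi> n \<otimes>\<^bsub>G\<^esub> inv\<^bsub>G\<^esub> t) \<otimes>\<^bsub>G\<^esub> (g \<otimes>\<^bsub>G\<^esub> \<psi>)" using abs by blast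
    then show "\<exists>x\<in>carrier G. \<exists>y\<in>carrier G.
      \<phi> n = (x \<otimes>\<^bsub>G\<^esub> \<psi> \<otimes>\<^bsub>G\<^esub> inv\<^bsub>G\<^esub> x) \<otimes>\<^bsub>G\<^esub> (y \<otimes>\<^bsub>G\<^esub> inv\<^bsub>G\<^esub> \<psi> \<otimes>\<^bsub>G\<^esub> inv\<^bsub>G\<^esub> y)"
      using G.conjugated_commutator[OF _ \<phi> \<psi>] by (meson G.inv_closed G.m_closed)
  qed
qed

end

theorem proposition2p6:
  fixes Sig :: "'f signature" and E :: "'f identities"
    and F :: "('f, 'a) universal_algebra" and B :: "'a set" and lam :: "'c rel"
  assumes "is_identities Sig E"
    and "free_basis Sig E F B"
    and "infinite B"
    and "Cinfinite lam"
    and "lam <o |B|"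
  shows "finite_C_width (Aut_le lam B Sig F)"
proof -
  interpret bounded_support Sig E F B lam
    using assms by unfold_locales
  show ?thesis by (rule finite_C_width_G)
qed

end
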